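(* Let $q$ be a prime power, $\mathbb{F}_q$ the field with $q$ elements and $n\ge1$ an integer. In $\mathbb{F}_q[\mathbf{x},\mathbf{y}]=\mathbb{F}_q[x_1,y_1,\dots,x_n,y_n]$ let $f_{i,j}=x_iy_j-y_ix_j$ for $1\le i,j\le n$, and let $$p_i=x_i^qy_i-x_iy_i^q,\qquad 1\le i\le n.$$ Then: (1) $G\cdot p_i=\det(G)\,p_i$ for every $G\in\mathrm{GL}_2(\mathbb{F}_q)$ and every $1\le i\le n$; consequently $p_i\in\mathbb{F}_q[\mathbf{x},\mathbf{y}]^{\mathrm{SL}_2}$ for all $i$, and $p_i/p_j\in\mathbb{F}_q(\mathbf{x},\mathbf{y})^{\mathrm{GL}_2}$ for all $i\ne j$; (2) $p_i\notin\mathbb{F}_q[f_{k,l}:1\le k,l\le n]$ for every $1\le i\le n$; (3) the inclusions $$\mathbb{F}_q[f_{i,j}:1\le i,j\le n]\subsetneq\mathbb{F}_q[\mathbf{x},\mathbf{y}]^{\mathrm{SL}_2}\quad\text{and}\quad \mathbb{F}_q\left(\frac{f_{i,j}}{f_{k,l}}:1\le i,j,k,l\le n,\ k\ne l\right)\subsetneq\mathbb{F}_q(\mathbf{x},\mathbf{y})^{\mathrm{GL}_2}$$ are strict.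
   Context: The group $\mathrm{GL}_2(\mathbb{F}_q)$ acts on $\mathbb{F}_q[x_1,y_1,\dots,x_n,y_n]$, and hence on its quotient field $\mathbb{F}_q(\mathbf{x},\mathbf{y})$, by matrix-vector multiplication on each pair of variables: for $G=\begin{pmatrix}a&b\\c&d\end{pmatrix}$, the element $G\cdot p$ is obtained from $p$ by substituting $x_i\mapsto ax_i+by_i$ and $y_i\mapsto cx_i+dy_i$ simultaneously for all $i$. $\mathbb{F}_q(\mathbf{x},\mathbf{y})^{\mathrm{GL}_2}$ denotes the field of elements fixed by $\mathrm{GL}_2(\mathbb{F}_q)$, and $\mathbb{F}_q[\mathbf{x},\mathbf{y}]^{\mathrm{SL}_2}$ the ring of polynomials fixed by $\mathrm{SL}_2(\mathbb{F}_q)$. $\mathbb{F}_q[f_{i,j}:1\le i,j\le n]$ is the $\mathbb{F}_q$-subalgebra generated by the $f_{i,j}$. When there are no quotients $f_{i,j}/f_{k,l}$ with $k\neq l$ (the case $n=1$), the subfield they generate is $\mathbb{F}_q$. *)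

theory Defs
  imports
    "HOL-Analysis.Determinants"
    "HOL-Library.Poly_Mapping"
    "HOL-Library.Countable"
    "HOL-Computational_Algebra.Fraction_Field"
begin

section \<open>The ring of polynomials in the variables $x_i$, $y_i$ and its quotient field\<close>

datatype 'n xy = X 'n | Y 'n

instance xy :: (countable) countable
  by countable_datatype

text \<open>
  The order on the variables has no mathematical content: it only serves to obtain the
  \<^class>\<open>idom\<close> instance of \<open>\<Rightarrow>\<^sub>0\<close>, which the library states for ordered exponents.
\<close>

instantiation xy :: (countable) linorder
begin

definition "v \<le> w \<longleftrightarrow> to_nat (v :: 'a xy) \<le> to_nat w"

definition "v < w \<longleftrightarrow> to_nat (v :: 'a xy) < to_nat w"

instance
  by standard (auto simp: less_eq_xy_def less_xy_def)

end

type_synonym ('n, 'a) mpoly = "('n xy \<Rightarrow>\<^sub>0 nat) \<Rightarrow>\<^sub>0 'a"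

type_synonym ('n, 'a) ratfun = "('n, 'a) mpoly fract"

definition Const :: "'a::comm_ring_1 \<Rightarrow> ('n, 'a) mpoly"
  where "Const c = Poly_Mapping.single 0 c"

definition Var :: "'n xy \<Rightarrow> ('n, 'a::comm_ring_1) mpoly"
  where "Var v = Poly_Mapping.single (Poly_Mapping.single v 1) 1"

definition subst :: "('n xy \<Rightarrow> ('n, 'a::comm_ring_1) mpoly) \<Rightarrow> ('n, 'a) mpoly \<Rightarrow> ('n, 'a) mpoly"
  where "subst \<sigma> p =
    (\<Sum>m\<in>Poly_Mapping.keys p. Const (Poly_Mapping.lookup p m) *
       (\<Prod>v\<in>Poly_Mapping.keys m. \<sigma> v ^ Poly_Mapping.lookup m v))"


section \<open>The action of $2\times 2$ matrices\<close>

primrec lin_subst :: "'a::comm_ring_1^2^2 \<Rightarrow> 'n xy \<Rightarrow> ('n, 'a) mpoly"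
  where
    "lin_subst G (X i) = Const (G $ 1 $ 1) * Var (X i) + Const (G $ 1 $ 2) * Var (Y i)"
  | "lin_subst G (Y i) = Const (G $ 2 $ 1) * Var (X i) + Const (G $ 2 $ 2) * Var (Y i)"

definition act :: "'a::comm_ring_1^2^2 \<Rightarrow> ('n, 'a) mpoly \<Rightarrow> ('n, 'a) mpoly"
  where "act G = subst (lin_subst G)"

text \<open>
  The induced action on the quotient field, meaningful for invertible \<open>G\<close> only;
  see \<open>frac_act_Fract\<close> below.
\<close>

definition frac_act ::
    "'a::field^2^2 \<Rightarrow> ('n::countable, 'a) ratfun \<Rightarrow> ('n, 'a) ratfun"
  where "frac_act G r =
    (THE s. \<exists>a b. b \<noteq> 0 \<and> r = Fract a b \<and> s = Fract (act G a) (act G b))"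

definition SL2_invariants :: "('n, 'a::field) mpoly set"
  where "SL2_invariants = {p. \<forall>G::'a^2^2. det G = 1 \<longrightarrow> act G p = p}"

definition GL2_invariants :: "('n::countable, 'a::field) ratfun set"
  where "GL2_invariants = {r. \<forall>G::'a^2^2. invertible G \<longrightarrow> frac_act G r = r}"


section \<open>Generated subalgebras and subfields\<close>

inductive_set gen_subalgebra :: "('n, 'a::field) mpoly set \<Rightarrow> ('n, 'a) mpoly set"
  for S where
    const: "Const c \<in> gen_subalgebra S"
  | gen: "s \<in> S \<Longrightarrow> s \<in> gen_subalgebra S"
  | add: "p \<in> gen_subalgebra S \<Longrightarrow> r \<in> gen_subalgebra S \<Longrightarrow> p + r \<in> gen_subalgebra S"
  | mult: "p \<in> gen_subalgebra S \<Longrightarrow> r \<in> gen_subalgebra S \<Longrightarrow> p * r \<in> gen_subalgebra S"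

inductive_set gen_subfield ::
    "('n::countable, 'a::field) ratfun set \<Rightarrow> ('n, 'a) ratfun set"
  for S where
    const: "Fract (Const c) 1 \<in> gen_subfield S"
  | gen: "s \<in> S \<Longrightarrow> s \<in> gen_subfield S"
  | add: "p \<in> gen_subfield S \<Longrightarrow> r \<in> gen_subfield S \<Longrightarrow> p + r \<in> gen_subfield S"
  | mult: "p \<in> gen_subfield S \<Longrightarrow> r \<in> gen_subfield S \<Longrightarrow> p * r \<in> gen_subfield S"
  | inverse: "p \<in> gen_subfield S \<Longrightarrow> inverse p \<in> gen_subfield S"


section \<open>The action on the quotient field is well defined\<close>

lemma Const_0 [simp]: "Const 0 = 0"
  and Const_1 [simp]: "Const 1 = 1"
  and Const_add: "Const (a + b) = Const a + Const b"
  and Const_mult: "Const (a * b) = Const a * Const b"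
  by (simp_all add: Const_def single_add mult_single flip: single_one)

lemma subst_superset:
  assumes "finite A" "Poly_Mapping.keys p \<subseteq> A"
  shows "subst \<sigma> p = (\<Sum>m\<in>A. Const (Poly_Mapping.lookup p m) *
    (\<Prod>v\<in>Poly_Mapping.keys m. \<sigma> v ^ Poly_Mapping.lookup m v))"
  unfolding subst_def using assms
  by (intro sum.mono_neutral_left) (auto simp: in_keys_iff)

lemma subst_add: "subst \<sigma> (p + r) = subst \<sigma> p + subst \<sigma> r"
proof -
  let ?A = "Poly_Mapping.keys p \<union> Poly_Mapping.keys r"
  have "Poly_Mapping.keys (p + r) \<subseteq> ?A"
    by (rule keys_add)
  then show ?thesis
    by (simp add: subst_superset[of ?A] lookup_add Const_add algebra_simps sum.distrib)
qed

lemma subst_0 [simp]: "subst \<sigma> 0 = 0"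
  by (simp add: subst_def)

lemma subst_sum: "subst \<sigma> (sum g A) = (\<Sum>a\<in>A. subst \<sigma> (g a))"
  by (induction A rule: infinite_finite_induct) (simp_all add: subst_add)

lemma subst_single: "subst \<sigma> (Poly_Mapping.single m c) =
    Const c * (\<Prod>v\<in>Poly_Mapping.keys m. \<sigma> v ^ Poly_Mapping.lookup m v)"
  by (subst subst_superset[of "{m}"]) auto

lemma prod_keys_superset:
  assumes "finite A" "Poly_Mapping.keys m \<subseteq> A"
  shows "(\<Prod>v\<in>Poly_Mapping.keys m. \<sigma> v ^ Poly_Mapping.lookup m v)
    = (\<Prod>v\<in>A. \<sigma> v ^ Poly_Mapping.lookup m v :: 'b::comm_semiring_1)"
  using assms by (intro prod.mono_neutral_left) (auto simp: in_keys_iff)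

lemma subst_mult_single:
  "subst \<sigma> (Poly_Mapping.single m c * Poly_Mapping.single m' c') =
    subst \<sigma> (Poly_Mapping.single m c) * subst \<sigma> (Poly_Mapping.single m' c')"
proof -
  let ?A = "Poly_Mapping.keys m \<union> Poly_Mapping.keys m'"
  have *: "(\<Prod>v\<in>Poly_Mapping.keys n. \<sigma> v ^ Poly_Mapping.lookup n v) =
      (\<Prod>v\<in>?A. \<sigma> v ^ Poly_Mapping.lookup n v)" if "n \<in> {m, m', m + m'}" for n
    using that keys_add[of m m'] by (intro prod_keys_superset) auto
  show ?thesis
    unfolding mult_single subst_single
    by (subst (1 2 3) *) (simp_all only: insert_iff simp_thms lookup_add power_add prod.distrib Const_mult mult_ac)
qed

lemma sum_singles:
  "(\<Sum>m\<in>Poly_Mapping.keys p. Poly_Mapping.single m (Poly_Mapping.lookup p m)) = p"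
  by (rule poly_mapping_eqI) (simp add: lookup_sum lookup_single when_def in_keys_iff)

lemma subst_mult: "subst \<sigma> (p * r) = subst \<sigma> p * subst \<sigma> r"
proof -
  let ?s = "\<lambda>p m. Poly_Mapping.single m (Poly_Mapping.lookup p m)"
  have "subst \<sigma> (p * r) = subst \<sigma>
      ((\<Sum>m\<in>Poly_Mapping.keys p. ?s p m) * (\<Sum>m\<in>Poly_Mapping.keys r. ?s r m))"
    by (simp add: sum_singles)
  also have "\<dots> = subst \<sigma> (\<Sum>m\<in>Poly_Mapping.keys p. ?s p m) *
      subst \<sigma> (\<Sum>m\<in>Poly_Mapping.keys r. ?s r m)"
    by (simp only: sum_product subst_sum subst_mult_single)
  finally show ?thesis
    by (simp add: sum_singles)
qed

lemma subst_Const [simp]: "subst \<sigma> (Const c) = Const c"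
  by (simp add: Const_def subst_single)

lemma subst_1 [simp]: "subst \<sigma> 1 = 1"
  by (metis Const_1 subst_Const)

lemma subst_Var [simp]: "subst \<sigma> (Var v) = \<sigma> v"
  by (simp add: Var_def subst_single)

lemma subst_power: "subst \<sigma> (p ^ k) = subst \<sigma> p ^ k"
  by (induction k) (simp_all add: subst_mult)

lemma subst_prod: "subst \<sigma> (prod g A) = (\<Prod>a\<in>A. subst \<sigma> (g a))"
  by (induction A rule: infinite_finite_induct) (simp_all add: subst_mult)

lemma subst_subst: "subst \<sigma> (subst \<tau> p) = subst (\<lambda>v. subst \<sigma> (\<tau> v)) p"
proof -
  have "subst \<sigma> (subst \<tau> p) = subst \<sigma>
    (\<Sum>m\<in>Poly_Mapping.keys p. Const (Poly_Mapping.lookup p m) *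
       (\<Prod>v\<in>Poly_Mapping.keys m. \<tau> v ^ Poly_Mapping.lookup m v))"
    by (simp only: subst_def[of \<tau>])
  also have "\<dots> = subst (\<lambda>v. subst \<sigma> (\<tau> v)) p"
    by (simp add: subst_sum subst_mult subst_prod subst_power)
       (simp only: subst_def[of "\<lambda>v. subst \<sigma> (\<tau> v)"])
  finally show ?thesis .
qed

lemma Var_power: "Var v ^ k = Poly_Mapping.single (Poly_Mapping.single v k) 1"
  by (induction k) (simp_all add: Var_def mult_single single_add[symmetric])

lemma prod_Var:
  "finite A \<Longrightarrow> (\<Prod>v\<in>A. Poly_Mapping.single (g v) 1 :: ('n, 'a::comm_ring_1) mpoly) =
    Poly_Mapping.single (\<Sum>v\<in>A. g v) 1"
  by (induction A rule: finite_induct) (simp_all add: mult_single)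

lemma subst_id: "subst Var p = p"
  by (simp add: subst_def Var_power prod_Var sum_singles Const_def mult_single)

lemma act_act:
  fixes p :: "('b, 'a::comm_ring_1) mpoly"
  shows "act G (act H p) = act (H ** G) p"
proof -
  have "subst (lin_subst G) (lin_subst H v) = lin_subst (H ** G) v" for v :: "'b xy"
    by (cases v) (simp_all add: subst_add subst_mult matrix_matrix_mult_def sum_2
        Const_add Const_mult algebra_simps)
  then show ?thesis
    by (simp add: act_def subst_subst)
qed

lemma act_mat_1:
  fixes p :: "('b, 'a::comm_ring_1) mpoly"
  shows "act (mat 1) p = p"
proof -
  have "lin_subst (mat 1 :: 'a^2^2) v = Var v" for v :: "'b xy"
    by (cases v) (simp_all add: mat_def)
  then have "lin_subst (mat 1 :: 'a^2^2) = (Var :: 'b xy \<Rightarrow> _)"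
    by (rule ext)
  then show ?thesis
    by (simp add: act_def subst_id)
qed

lemma act_eq_0_iff:
  assumes "invertible G"
  shows "act G p = 0 \<longleftrightarrow> p = 0"
proof
  assume *: "act G p = 0"
  obtain H where "G ** H = mat 1"
    using assms by (auto simp: invertible_def)
  then have "act H (act G p) = p"
    by (simp add: act_act act_mat_1)
  with * show "p = 0"
    by (simp add: act_def)
qed (simp add: act_def)

lemma frac_act_Fract:
  assumes G: "invertible G" and b: "b \<noteq> 0"
  shows "frac_act G (Fract a b) = Fract (act G a) (act G b)"
  unfolding frac_act_def
proof (rule the_equality)
  fix s
  assume "\<exists>a' b'. b' \<noteq> 0 \<and> Fract a b = Fract a' b' \<and> s = Fract (act G a') (act G b')"
  then obtain a' b' where *: "b' \<noteq> 0" "Fract a b = Fract a' b'"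
      "s = Fract (act G a') (act G b')"
    by blast
  then have "a * b' = a' * b"
    using b by (simp add: eq_fract)
  then have "act G a * act G b' = act G a' * act G b"
    by (metis act_def subst_mult)
  then show "s = Fract (act G a) (act G b)"
    using * b G by (simp add: eq_fract act_eq_0_iff)
qed (use b in blast)

end

(* The form p_i transforms by the determinant because c^q = c on F_q and the q-th power map is
   additive.

   Strictness comes from two gradings by weights of the variables. Under the weights 1 of x_i and
   -1 of y_i every f_{k,l} has weight 0, whereas p_i contains the monomial x_i^q y_i of weight q - 1 > 0.
   Under the total degree every quotient f_{i,j}/f_{k,l} has degree 0, whereas p_i^(q-1), which is
   GL_2-invariant since det(G)^(q-1) = 1, has positive degree. The latter witness also covers n = 1. *)

theory Submission
  imports Defs "HOL-Computational_Algebra.Polynomial"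
begin

section \<open>Finite fields: Fermat's identity and additivity of the q-th power map\<close>

lemma finite_field_power_card_minus_1:
  fixes x :: "'a::{field, finite}"
  assumes "x \<noteq> 0"
  shows "x ^ (CARD('a) - 1) = 1"
proof -
  let ?U = "UNIV - {0 :: 'a}"
  \<comment> \<open>Multiplication by \<open>x\<close> permutes the nonzero elements, so it
    preserves their product, which is nonzero and can be cancelled.\<close>
  have "bij_betw ((*) x) ?U ?U"
    by (rule bij_betw_byWitness[of _ "\<lambda>y. y / x"]) (use assms in auto)
  then have "(\<Prod>y\<in>?U. x * y) = \<Prod>?U"
    by (rule prod.reindex_bij_betw)
  then have "x ^ card ?U * \<Prod>?U = \<Prod>?U"
    by (simp add: prod.distrib)
  moreover have "\<Prod>?U \<noteq> 0"
    by simp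
  ultimately show ?thesis
    by (simp add: card_Diff_singleton)
qed

lemma finite_field_power_card:
  fixes x :: "'a::{field, finite}"
  shows "x ^ CARD('a) = x"
proof (cases "x = 0")
  case False
  have "x ^ CARD('a) = x * x ^ (CARD('a) - 1)"
    by (metis power_eq_if finite_UNIV_card_ge_0 finite less_numeral_extra(3))
  then show ?thesis
    using finite_field_power_card_minus_1[OF False] by simp
qed simp

lemma one_less_CARD_field: "1 < CARD('a::{field, finite})"
proof -
  have "card {0, 1 :: 'a} \<le> CARD('a)"
    by (rule card_mono) auto
  then show ?thesis
    by simp
qed

text \<open>
  The polynomials \<open>(1 + T)\<^sup>q\<close> and \<open>1 + T\<^sup>q\<close> have the same leading term and agree at all \<open>q\<close>
  points of the field, so they are equal.
\<close>

lemma of_nat_CARD_choose_eq_0: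
  assumes "0 < k" "k < CARD('a::{field, finite})"
  shows "of_nat (CARD('a) choose k) = (0 :: 'a)"
proof -
  let ?q = "CARD('a)" and ?P = "[:1, 1:] :: 'a poly"
  have deg: "degree (?P ^ ?q) = ?q"
    by (simp add: degree_power_eq)
  have "?P ^ ?q = 1 + monom 1 ?q"
  proof (rule poly_eqI_degree_lead_coeff[where n = ?q and A = UNIV])
    show "degree (1 + monom (1 :: 'a) ?q) \<le> ?q"
      by (intro degree_add_le) (simp_all add: degree_monom_le)
    show "coeff (?P ^ ?q) ?q = coeff (1 + monom 1 ?q) ?q"
      using lead_coeff_power[of "?P" ?q] by (simp add: deg)
  qed (simp_all add: deg poly_monom finite_field_power_card)
  \<comment> \<open>Strictly between degrees 0 and q the right side has no term; the left side has
    the binomial coefficient there.\<close>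
  then have "coeff (?P ^ ?q) k = 0"
    using assms by simp
  then show ?thesis
    using assms by (simp add: coeff_linear_poly_power)
qed

lemma of_nat_eq_Const: "of_nat k = Const (of_nat k)"
  by (induction k) (simp_all add: Const_add)

lemma Const_power: "Const (c ^ k) = Const c ^ k"
  by (induction k) (simp_all add: Const_mult)

lemma Const_diff: "Const (a - b) = Const a - Const b"
  by (simp add: Const_def single_diff)

text \<open>All inner terms of the binomial expansion vanish: their integer coefficients, read as
  constants, are 0 in the field. Prime powers q are covered without reference to the
  characteristic.\<close>

lemma mpoly_add_power_CARD:
  fixes p r :: "('n, 'a::{field, finite}) mpoly"
  shows "(p + r) ^ CARD('a) = p ^ CARD('a) + r ^ CARD('a)"
proof -
  let ?q = "CARD('a)"
  let ?t = "\<lambda>k. of_nat (?q choose k) * p ^ k * r ^ (?q - k)"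
  have "(p + r) ^ ?q = (\<Sum>k\<le>?q. ?t k)"
    by (rule binomial_ring)
  also have "\<dots> = (\<Sum>k\<in>{0, ?q}. ?t k)"
    by (rule sum.mono_neutral_right) (auto simp: of_nat_eq_Const of_nat_CARD_choose_eq_0)
  also have "\<dots> = p ^ ?q + r ^ ?q"
    by simp
  finally show ?thesis .
qed


section \<open>Invariance\<close>

lemma act_Const [simp]: "act G (Const c) = Const c"
  and act_0 [simp]: "act G 0 = 0"
  and act_1 [simp]: "act G 1 = 1"
  and act_add: "act G (p + r) = act G p + act G r"
  and act_mult: "act G (p * r) = act G p * act G r"
  and act_power: "act G (p ^ k) = act G p ^ k"
  by (simp_all add: act_def subst_add subst_mult subst_power)

lemma act_diff: "act G (p - r) = act G p - act G r"
  using act_add[of G "p - r" r] by (simp add: algebra_simps)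

lemma act_Var:
  "act G (Var (X i)) = Const (G $ 1 $ 1) * Var (X i) + Const (G $ 1 $ 2) * Var (Y i)"
  "act G (Var (Y i)) = Const (G $ 2 $ 1) * Var (X i) + Const (G $ 2 $ 2) * Var (Y i)"
  by (simp_all add: act_def)

text \<open>This is the determinant of the matrix with columns (x_i, y_i) and (x_j, y_j), which the
  action multiplies by \<open>G\<close> from the left.\<close>

lemma act_minor:
  "act G (Var (X i) * Var (Y j) - Var (Y i) * Var (X j)) =
    Const (det G) * (Var (X i) * Var (Y j) - Var (Y i) * Var (X j))"
  by (simp add: act_diff act_mult act_Var det_2 Const_diff Const_mult algebra_simps)

text \<open>Since c^q = c for the entries of \<open>G\<close>, the vector (x_i^q, y_i^q) transforms
  by the same matrix as (x_i, y_i).\<close>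

lemma act_Var_power_CARD:
  fixes G :: "'a::{field, finite}^2^2"
  shows "act G (Var (X i)) ^ CARD('a) =
      Const (G $ 1 $ 1) * Var (X i) ^ CARD('a) + Const (G $ 1 $ 2) * Var (Y i) ^ CARD('a)"
    and "act G (Var (Y i)) ^ CARD('a) =
      Const (G $ 2 $ 1) * Var (X i) ^ CARD('a) + Const (G $ 2 $ 2) * Var (Y i) ^ CARD('a)"
  by (simp_all add: act_Var mpoly_add_power_CARD power_mult_distrib finite_field_power_card
      flip: Const_power)

text \<open>The form is the determinant with columns (x_i^q, y_i^q) and (x_i, y_i), and
  \<open>G\<close> acts on both columns alike.\<close>

lemma act_Dickson:
  fixes G :: "'a::{field, finite}^2^2"
  shows "act G (Var (X i) ^ CARD('a) * Var (Y i) - Var (X i) * Var (Y i) ^ CARD('a)) =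
    Const (det G) * (Var (X i) ^ CARD('a) * Var (Y i) - Var (X i) * Var (Y i) ^ CARD('a))"
  unfolding act_diff act_mult act_power act_Var_power_CARD
  by (simp add: act_Var det_2 Const_diff Const_mult algebra_simps)

lemma SL2_invariantI:
  assumes "\<And>G::'a::field^2^2. invertible G \<Longrightarrow> act G p = Const (det G) * p"
  shows "p \<in> SL2_invariants"
  using assms by (simp add: SL2_invariants_def invertible_det_nz)

section \<open>Compatibility of the action on rational functions with the field operations\<close>

lemma frac_act_0 [simp]:
  assumes "invertible G"
  shows "frac_act G 0 = 0"
  using frac_act_Fract[OF assms, of 1 0] by (simp add: fract_collapse)

lemma frac_act_add:
  assumes G: "invertible G"
  shows "frac_act G (r + s) = frac_act G r + frac_act G s"
proof (cases r, cases s)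
  fix a b c d
  assume "r = Fract a b" "b \<noteq> 0" "s = Fract c d" "d \<noteq> 0"
  then show ?thesis
    using G by (simp add: frac_act_Fract act_eq_0_iff act_add act_mult)
qed

lemma frac_act_mult:
  assumes G: "invertible G"
  shows "frac_act G (r * s) = frac_act G r * frac_act G s"
proof (cases r, cases s)
  fix a b c d
  assume "r = Fract a b" "b \<noteq> 0" "s = Fract c d" "d \<noteq> 0"
  then show ?thesis
    using G by (simp add: frac_act_Fract act_mult)
qed

lemma frac_act_inverse:
  assumes G: "invertible G"
  shows "frac_act G (inverse r) = inverse (frac_act G r)"
\<comment> \<open>Inversion moves the numerator into the denominator, where
  \<open>frac_act_Fract\<close> requires it to be nonzero; at 0 the convention
  \<open>inverse 0 = 0\<close> applies.\<close>
proof (cases "r = 0")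
  case False
  then obtain a b where "r = Fract a b" "a \<noteq> 0" "b \<noteq> 0"
    by (cases r rule: Fract_cases_nonzero) auto
  then show ?thesis
    using G by (simp add: frac_act_Fract)
qed (use G in simp)

text \<open>The factor \<open>det G\<close> cancels. Admitting \<open>b = 0\<close>, where the
  fraction is 0, spares nonvanishing proofs for the denominators.\<close>

lemma GL2_invariant_quotient:
  fixes a b :: "('n::countable, 'a::field) mpoly"
  assumes a: "\<And>G::'a^2^2. invertible G \<Longrightarrow> act G a = Const (det G) * a"
    and b: "\<And>G::'a^2^2. invertible G \<Longrightarrow> act G b = Const (det G) * b"
  shows "Fract a b \<in> GL2_invariants"
  unfolding GL2_invariants_def
proof (intro CollectI allI impI)
  fix G :: "'a^2^2"
  assume G: "invertible G"
  show "frac_act G (Fract a b) = Fract a b"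
  proof (cases "b = 0")
    case True
    with G show ?thesis
      by (simp add: fract_collapse)
  next
    case False
    then have "act G b \<noteq> 0"
      using G by (simp add: act_eq_0_iff)
    then show ?thesis
      using G False by (simp add: frac_act_Fract eq_fract a b)
  qed
qed

lemma gen_subalgebra_subset_SL2_invariants:
  assumes "S \<subseteq> SL2_invariants"
  shows "gen_subalgebra S \<subseteq> SL2_invariants"
proof
  fix p
  assume "p \<in> gen_subalgebra S"
  then show "p \<in> SL2_invariants"
    by induction (use assms in \<open>auto simp: SL2_invariants_def act_add act_mult\<close>)
qed

lemma gen_subfield_subset_GL2_invariants:
  assumes "S \<subseteq> GL2_invariants"
  shows "gen_subfield S \<subseteq> GL2_invariants"
proof
  fix r
  assume "r \<in> gen_subfield S"
  then show "r \<in> GL2_invariants"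
    by induction (use assms in \<open>auto simp: GL2_invariants_def frac_act_Fract frac_act_add
        frac_act_mult frac_act_inverse\<close>)
qed


section \<open>Gradings\<close>

text \<open>Weights are integers because one of the two gradings gives every y_i weight -1.\<close>

definition weight :: "('v \<Rightarrow> int) \<Rightarrow> ('v \<Rightarrow>\<^sub>0 nat) \<Rightarrow> int"
  where "weight w m = (\<Sum>v\<in>Poly_Mapping.keys m. int (Poly_Mapping.lookup m v) * w v)"

text \<open>Zero is homogeneous of every degree, so each degree is closed under sums.\<close>

definition homogeneous :: "('v \<Rightarrow> int) \<Rightarrow> int \<Rightarrow> (('v \<Rightarrow>\<^sub>0 nat) \<Rightarrow>\<^sub>0 'a::zero) \<Rightarrow> bool"
  where "homogeneous w d p \<longleftrightarrow> (\<forall>m\<in>Poly_Mapping.keys p. weight w m = d)"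

lemma weight_superset:
  assumes "finite A" "Poly_Mapping.keys m \<subseteq> A"
  shows "weight w m = (\<Sum>v\<in>A. int (Poly_Mapping.lookup m v) * w v)"
  unfolding weight_def using assms
  by (intro sum.mono_neutral_left) (auto simp: in_keys_iff)

lemma weight_add: "weight w (m + m') = weight w m + weight w m'"
proof -
  let ?A = "Poly_Mapping.keys m \<union> Poly_Mapping.keys m'"
  have "Poly_Mapping.keys (m + m') \<subseteq> ?A"
    by (rule keys_add)
  then show ?thesis
    by (simp add: weight_superset[of ?A] lookup_add algebra_simps sum.distrib)
qed

lemma weight_single [simp]: "weight w (Poly_Mapping.single v k) = int k * w v"
  by (simp add: weight_def)

lemma homogeneous_add:
  "homogeneous w d p \<Longrightarrow> homogeneous w d r \<Longrightarrow> homogeneous w d (p + r)"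
  using keys_add[of p r] by (auto simp: homogeneous_def)

lemma homogeneous_diff:
  fixes p r :: "('v \<Rightarrow>\<^sub>0 nat) \<Rightarrow>\<^sub>0 'a::ab_group_add"
  shows "homogeneous w d p \<Longrightarrow> homogeneous w d r \<Longrightarrow> homogeneous w d (p - r)"
  using keys_diff[of p r] by (auto simp: homogeneous_def)

lemma homogeneous_mult:
  fixes p r :: "('v \<Rightarrow>\<^sub>0 nat) \<Rightarrow>\<^sub>0 'a::comm_ring_1"
  shows "homogeneous w d p \<Longrightarrow> homogeneous w e r \<Longrightarrow> homogeneous w (d + e) (p * r)"
  using keys_mult[of p r] by (fastforce simp: homogeneous_def weight_add)

lemma homogeneous_Const: "homogeneous w 0 (Const c)"
  by (simp add: homogeneous_def Const_def weight_def)

lemma homogeneous_0 [simp]: "homogeneous w d 0"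
  by (simp add: homogeneous_def)

lemma homogeneous_1: "homogeneous w 0 (1 :: ('v \<Rightarrow>\<^sub>0 nat) \<Rightarrow>\<^sub>0 'a::comm_ring_1)"
  by (simp add: homogeneous_def weight_def)

lemma homogeneous_Var: "homogeneous w (w v) (Var v)"
  by (simp add: homogeneous_def Var_def)

lemma homogeneous_power:
  fixes p :: "('v \<Rightarrow>\<^sub>0 nat) \<Rightarrow>\<^sub>0 'a::comm_ring_1"
  assumes "homogeneous w d p"
  shows "homogeneous w (int k * d) (p ^ k)"
proof (induction k)
  case (Suc k)
  then show ?case
    using homogeneous_mult[OF assms Suc] by (simp add: algebra_simps)
qed (simp add: homogeneous_1)

lemma homogeneous_unique:
  assumes "homogeneous w d p" "homogeneous w e p" "p \<noteq> 0"
  shows "d = e"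
proof -
  obtain m where "m \<in> Poly_Mapping.keys p"
    using \<open>p \<noteq> 0\<close> by (metis ex_in_conv keys_eq_empty)
  then show ?thesis
    using assms by (auto simp: homogeneous_def)
qed

text \<open>Serves both gradings: \<open>d = 0\<close> for the weights 1 and -1,
  \<open>d = 2\<close> for the total degree.\<close>

lemma homogeneous_minor:
  assumes "w (X i) + w (Y j) = d" "w (Y i) + w (X j) = d"
  shows "homogeneous w d (Var (X i) * Var (Y j) - Var (Y i) * Var (X j))"
  using homogeneous_mult[OF homogeneous_Var homogeneous_Var, of w "X i" "Y j"]
    homogeneous_mult[OF homogeneous_Var homogeneous_Var, of w "Y i" "X j"] assms
  by (intro homogeneous_diff) simp_all

text \<open>The degree-0 part of a grading contains the constants and is closed under sums and
  products.\<close>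

lemma gen_subalgebra_homogeneous:
  assumes "p \<in> gen_subalgebra S" "\<And>s. s \<in> S \<Longrightarrow> homogeneous w 0 s"
  shows "homogeneous w 0 p"
  using assms(1)
proof induction
  case (mult p r)
  then show ?case
    using homogeneous_mult[of w 0 p 0 r] by simp
qed (simp_all add: assms homogeneous_Const homogeneous_add)

text \<open>The degree-0 part of the localization at the nonzero homogeneous elements; the common
  degree \<open>d\<close> may vary with the fraction.\<close>

definition degree_zero_fractions ::
    "('n xy \<Rightarrow> int) \<Rightarrow> ('n::countable, 'a::field) ratfun set"
  where "degree_zero_fractions w =
    {Fract a b | a b d. b \<noteq> 0 \<and> homogeneous w d a \<and> homogeneous w d b}"

lemma degree_zero_fractionsI:
  "b \<noteq> 0 \<Longrightarrow> homogeneous w d a \<Longrightarrow> homogeneous w d b \<Longrightarrow> Fract a b \<in> degree_zero_fractions w"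
  by (auto simp: degree_zero_fractions_def)

lemma degree_zero_fractionsE:
  assumes "r \<in> degree_zero_fractions w"
  obtains a b d where "r = Fract a b" "b \<noteq> 0" "homogeneous w d a" "homogeneous w d b"
  using assms by (auto simp: degree_zero_fractions_def)

lemma zero_in_degree_zero_fractions: "0 \<in> degree_zero_fractions w"
  using degree_zero_fractionsI[of 1 w 0 0] by (simp add: fract_collapse homogeneous_1)

text \<open>A zero denominator yields the fraction 0, itself of degree 0; inverses then need no case
  distinction.\<close>

lemma degree_zero_fractions_quotient:
  assumes "homogeneous w d a" "homogeneous w d b"
  shows "Fract a b \<in> degree_zero_fractions w"
  using assms zero_in_degree_zero_fractions[of w]
  by (cases "b = 0") (auto simp: fract_collapse intro: degree_zero_fractionsI)

text \<open>Fractions of degree 0 form a subfield: a common denominator has degree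
  \<open>d + d'\<close>, as do both cross products, and inversion swaps two elements of equal
  degree.\<close>

lemma gen_subfield_degree_zero_fractions:
  assumes "S \<subseteq> degree_zero_fractions w"
  shows "gen_subfield S \<subseteq> degree_zero_fractions w"
proof
  fix r
  assume "r \<in> gen_subfield S"
  then show "r \<in> degree_zero_fractions w"
  proof induction
    case (const c)
    then show ?case
      by (simp add: degree_zero_fractions_quotient[of w 0] homogeneous_Const homogeneous_1)
  next
    case (gen s)
    with assms show ?case
      by blast
  next
    case (add p r)
    obtain a b d where p: "p = Fract a b" "b \<noteq> 0" "homogeneous w d a" "homogeneous w d b"
      using add.IH(1) by (rule degree_zero_fractionsE)
    obtain a' b' d' where r: "r = Fract a' b'" "b' \<noteq> 0" "homogeneous w d' a'" "homogeneous w d' b'"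
      using add.IH(2) by (rule degree_zero_fractionsE)
    have "homogeneous w (d + d') (a * b' + a' * b)" "homogeneous w (d + d') (b * b')"
      using homogeneous_mult[OF p(3) r(4)] homogeneous_mult[OF r(3) p(4)]
        homogeneous_mult[OF p(4) r(4)]
      by (simp_all add: homogeneous_add add.commute)
    then show ?case
      using p r by (simp add: degree_zero_fractions_quotient)
  next
    case (mult p r)
    obtain a b d where p: "p = Fract a b" "b \<noteq> 0" "homogeneous w d a" "homogeneous w d b"
      using mult.IH(1) by (rule degree_zero_fractionsE)
    obtain a' b' d' where r: "r = Fract a' b'" "b' \<noteq> 0" "homogeneous w d' a'" "homogeneous w d' b'"
      using mult.IH(2) by (rule degree_zero_fractionsE)
    show ?case
      using degree_zero_fractions_quotient[OF homogeneous_mult[OF p(3) r(3)] homogeneous_mult[OF p(4) r(4)]]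
      by (simp add: p r)
  next
    case (inverse p)
    then show ?case
      by (auto elim!: degree_zero_fractionsE intro: degree_zero_fractions_quotient)
  qed
qed

text \<open>If a = b/c with b and c of degree e, then the nonzero product a c = b has both degrees d
  + e and e.\<close>

lemma homogeneous_in_degree_zero_fractions:
  assumes "Fract a 1 \<in> degree_zero_fractions w" "homogeneous w d a" "a \<noteq> 0"
  shows "d = 0"
proof -
  obtain b c e where bc: "Fract a 1 = Fract b c" "c \<noteq> 0" "homogeneous w e b" "homogeneous w e c"
    using assms(1) by (rule degree_zero_fractionsE)
  then have "a * c = b"
    by (simp add: eq_fract)
  then have "homogeneous w (d + e) (a * c)" "homogeneous w e (a * c)" "a * c \<noteq> 0"
    using homogeneous_mult[OF assms(2) bc(4)] bc assms(3) by auto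
  then have "d + e = e"
    by (rule homogeneous_unique)
  then show ?thesis
    by simp
qed

section \<open>The forms p_i in the two gradings\<close>

lemma Dickson_not_homogeneous:
  assumes k: "1 < k"
  shows "\<not> homogeneous (case_xy (\<lambda>_. 1) (\<lambda>_. -1)) 0
    (Var (X i) ^ k * Var (Y i) - Var (X i) * Var (Y i) ^ k :: ('n, 'a::comm_ring_1) mpoly)"
proof
  let ?m = "Poly_Mapping.single (X i) k + Poly_Mapping.single (Y i) 1"
  let ?m' = "Poly_Mapping.single (X i) 1 + Poly_Mapping.single (Y i) k"
  let ?w = "case_xy (\<lambda>_. 1) (\<lambda>_. -1) :: 'n xy \<Rightarrow> int"
  let ?p = "Var (X i) ^ k * Var (Y i) - Var (X i) * Var (Y i) ^ k :: ('n, 'a) mpoly"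
  assume hom: "homogeneous ?w 0 ?p"
  have weights: "weight ?w ?m = int k - 1" "weight ?w ?m' = 1 - int k"
    by (simp_all add: weight_add)
  \<comment> \<open>The weights are opposite and nonzero, so the two monomials differ and cannot
    cancel.\<close>
  then have "?m \<noteq> ?m'"
    using k by (metis diff_eq_eq eq_iff_diff_eq_0 less_irrefl minus_diff_eq of_nat_1 of_nat_eq_iff
        equal_neg_zero)
  have "?p = Poly_Mapping.single ?m 1 - Poly_Mapping.single ?m' 1"
    unfolding Var_power by (simp add: Var_def mult_single)
  then have "Poly_Mapping.lookup ?p ?m = 1"
    using \<open>?m \<noteq> ?m'\<close> by (simp add: lookup_minus lookup_single when_def)
  then have "?m \<in> Poly_Mapping.keys ?p"
    by (simp add: in_keys_iff)
  then show False
    using hom weights k by (simp add: homogeneous_def)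
qed

lemma homogeneous_Dickson:
  fixes k :: nat
  shows "homogeneous (\<lambda>_. 1) (int k + 1) (Var (X i) ^ k * Var (Y i) - Var (X i) * Var (Y i) ^ k)"
proof (rule homogeneous_diff)
  note pow = homogeneous_power[OF homogeneous_Var, where w = "\<lambda>_. 1"]
  show "homogeneous (\<lambda>_. 1) (int k + 1) (Var (X i) ^ k * Var (Y i))"
    using homogeneous_mult[OF pow homogeneous_Var] by simp
  show "homogeneous (\<lambda>_. 1) (int k + 1) (Var (X i) * Var (Y i) ^ k)"
    using homogeneous_mult[OF homogeneous_Var pow] by (simp add: add.commute)
qed


section \<open>Semi-invariance, non-membership and strictness for the given \<open>f\<close> and
  \<open>p\<close>\<close>

theorem mainTheorem3:
  fixes q :: nat
    and f :: "'n::finite \<Rightarrow> 'n \<Rightarrow> ('n, 'a::{field, finite}) mpoly"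
    and p :: "'n \<Rightarrow> ('n, 'a) mpoly"
  assumes q: "q = CARD('a)"
    and f: "\<And>i j. f i j = Var (X i) * Var (Y j) - Var (Y i) * Var (X j)"
    and p: "\<And>i. p i = Var (X i) ^ q * Var (Y i) - Var (X i) * Var (Y i) ^ q"
  shows
    "(\<forall>(G::'a^2^2) i. invertible G \<longrightarrow> act G (p i) = Const (det G) * p i) \<and>
     (\<forall>i. p i \<in> SL2_invariants) \<and>
     (\<forall>i j. i \<noteq> j \<longrightarrow> Fract (p i) (p j) \<in> GL2_invariants) \<and>
     (\<forall>i. p i \<notin> gen_subalgebra {f k l | k l. True}) \<and>
     gen_subalgebra {f i j | i j. True} \<subset> SL2_invariants \<and>
     gen_subfield {Fract (f i j) (f k l) | i j k l. k \<noteq> l} \<subset> GL2_invariants"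
proof -
  have q1: "1 < q"
    unfolding q by (rule one_less_CARD_field)
  have act_p: "act G (p i) = Const (det G) * p i" for G :: "'a^2^2" and i
    unfolding p q by (rule act_Dickson)
  have act_f: "act G (f i j) = Const (det G) * f i j" for G :: "'a^2^2" and i j
    unfolding f by (rule act_minor)
  have p_SL2: "p i \<in> SL2_invariants" for i
    by (rule SL2_invariantI) (rule act_p)
  have f_weight: "homogeneous (case_xy (\<lambda>_. 1) (\<lambda>_. -1)) 0 (f i j)" for i j
    unfolding f by (rule homogeneous_minor) simp_all
  have p_notin: "p i \<notin> gen_subalgebra {f k l | k l. True}" for i
  proof
    assume "p i \<in> gen_subalgebra {f k l | k l. True}"
    then have "homogeneous (case_xy (\<lambda>_. 1) (\<lambda>_. -1)) 0 (p i)"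
      by (rule gen_subalgebra_homogeneous) (use f_weight in blast)
    with Dickson_not_homogeneous[OF q1] show False
      unfolding p by (rule notE)
  qed
  have subalgebra: "gen_subalgebra {f i j | i j. True} \<subseteq> SL2_invariants"
    by (rule gen_subalgebra_subset_SL2_invariants) (auto intro!: SL2_invariantI act_f)
  have subfield: "gen_subfield {Fract (f i j) (f k l) | i j k l. k \<noteq> l} \<subseteq> GL2_invariants"
    by (rule gen_subfield_subset_GL2_invariants) (auto intro!: GL2_invariant_quotient act_f)

  \<comment> \<open>Any index serves, and one exists since types are nonempty. A witness with a
    single index also works for n = 1, where there are no quotients of distinct p_i.\<close>
  fix i :: 'n
  let ?r = "Fract (p i ^ (q - 1)) 1"
  have r_GL2: "?r \<in> GL2_invariants"
    unfolding GL2_invariants_def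
  proof (intro CollectI allI impI)
    fix G :: "'a^2^2"
    assume G: "invertible G"
    then have "det G ^ (q - 1) = 1"
      unfolding q by (intro finite_field_power_card_minus_1) (simp add: invertible_det_nz)
    then show "frac_act G ?r = ?r"
      using G by (simp add: frac_act_Fract act_power act_p power_mult_distrib flip: Const_power)
  qed
  have "?r \<notin> gen_subfield {Fract (f i j) (f k l) | i j k l. k \<noteq> l}"
  proof
    assume r: "?r \<in> gen_subfield {Fract (f i j) (f k l) | i j k l. k \<noteq> l}"
    have "homogeneous (\<lambda>_. 1) 2 (f i j)" for i j
      unfolding f by (rule homogeneous_minor) simp_all
    \<comment> \<open>Numerator and denominator both have total degree 2.\<close>
    then have "{Fract (f i j) (f k l) | i j k l. k \<noteq> l} \<subseteq> degree_zero_fractions (\<lambda>_. 1)"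
      by (auto intro: degree_zero_fractions_quotient)
    from gen_subfield_degree_zero_fractions[OF this] r
    have "?r \<in> degree_zero_fractions (\<lambda>_. 1)"
      by blast
    \<comment> \<open>Each p_i has total degree q + 1; the resulting degree q^2 - 1 is positive
      because q > 1.\<close>
    moreover have "homogeneous (\<lambda>_. 1) (int (q - 1) * (int q + 1)) (p i ^ (q - 1))"
      unfolding p by (intro homogeneous_power homogeneous_Dickson)
    \<comment> \<open>Zero is a constant, hence in the generated subalgebra, which does not contain
      \<open>p i\<close>.\<close>
    moreover have "p i \<noteq> 0"
      using p_notin[of i] gen_subalgebra.const[of 0 "{f k l | k l. True}"] by auto
    then have "p i ^ (q - 1) \<noteq> 0"
      by simp
    ultimately have "int (q - 1) * (int q + 1) = 0"
      by (rule homogeneous_in_degree_zero_fractions)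
    then show False
      using q1 by simp
  qed
  \<comment> \<open>\<open>p i\<close> witnesses the first strict inclusion and \<open>?r\<close>
    the second.\<close>
  with r_GL2 subfield subalgebra p_SL2 p_notin act_p show ?thesis
    by (auto intro!: GL2_invariant_quotient)
qed

end
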